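(* Let $X=(X_{m,n})$ and $Z=(Z_{m,n})$, $0\le m,n\le N$, be the $(N+1)\times(N+1)$ tridiagonal matrices with parameters $\alpha,\beta$ given in the context. The Jacobi matrix $(X+\mu Z)_{m,n}$ is diagonalized by the orthogonal polynomials $\tilde Q_n(y)=\sigma_nQ_n(x,\hat\alpha,\hat\beta,N)$, where $Q_n(x,\hat\alpha,\hat\beta,N)$ are the Hahn polynomials and $$x=y+\alpha+\mu,\qquad \hat\alpha=-1-\mu,\qquad \hat\beta=\beta+\mu-N,\qquad \sigma_n=\frac{(-1)^n(-N)_n}{(\hat\alpha+\hat\beta+N+2)_n}.$$
   Context: $(a)_k=a(a+1)\cdots(a+k-1)$ is the Pochhammer symbol. The Hahn polynomials are $$Q_n(x,\hat\alpha,\hat\beta,N)={}_3F_2\!\left({-n,\,n+\hat\alpha+\hat\beta+1,\,-x\atop \hat\alpha+1,\,-N};1\right),\quad n=0,\dots,N.$$ "Diagonalized" means that the polynomials satisfy the recurrence relation $$y\,\tilde Q_n(y)=(X+\mu Z)_{n+1,n}\tilde Q_{n+1}(y)+(X+\mu Z)_{n,n}\tilde Q_n(y)+(X+\mu Z)_{n-1,n}\tilde Q_{n-1}(y)$$ at the points $y=x-\alpha-\mu$, $x=0,1,\dots,N$ (terms with index $-1$ or $N+1$ being absent). The nonzero entries of $X$ and $Z$ ($n=0,\dots,N$) are $$X_{n+1,n}=\frac{n(\beta+n+1)(N-\beta-n)}{(N-\beta-2n)(N-\beta-2n-1)},\qquad X_{n-1,n}=\frac{n(N-\beta-n)(N-n+1)}{(N-\beta-2n)(N-\beta-2n+1)},$$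 $$X_{n,n}=-\alpha-n+\frac{\beta n(n-1)+n^2(n-1)}{N-\beta-2n+1}-\frac{\beta n(n+1)+n(n+1)^2}{N-\beta-2n-1},$$ $$Z_{n+1,n}=-\frac{(\beta+n+1)(N-\beta-n)}{(N-\beta-2n)(N-\beta-2n-1)},\qquad Z_{n-1,n}=-\frac{n(N-n+1)}{(N-\beta-2n)(N-\beta-2n+1)},$$ $$Z_{n,n}=\frac{(n+1)\beta+(n+1)^2}{N-\beta-2n-1}-\frac{\beta n+n^2}{N-\beta-2n+1},$$ with $X_{N+1,N}=Z_{N+1,N}=0$. Together with the diagonal matrix $V_{n,n}=-n(n-N+\beta)$ they represent the meta-Hahn algebra, in particular $[Z,X]=Z^2+Z$. Here $\alpha,\beta,\mu$ are real parameters. *)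

theory Defs
  imports "HOL-Analysis.FPS_Convergence" "Jordan_Normal_Form.Matrix"
begin

(* The series terminates because of the parameter -n.  For k > N the factor 1 / (-N)_k is 0 by
   division by zero, but for n \<le> N these terms vanish anyway, since (-n)_k = 0 for k > n. *)
definition hahn :: "nat \<Rightarrow> real \<Rightarrow> real \<Rightarrow> real \<Rightarrow> nat \<Rightarrow> real" where
  "hahn n x a b N =
     eval_fps (fps_hypergeo [- real n, real n + a + b + 1, - x] [a + 1, - real N] 1) 1"

(* Row and column indices start at 0; restricting to 0..N makes the entry at (N + 1, N) absent,
   which is the convention that it is zero. *)
definition X_mat :: "real \<Rightarrow> real \<Rightarrow> nat \<Rightarrow> real mat" where
  "X_mat \<alpha> \<beta> N = mat (N + 1) (N + 1) (\<lambda>(i, j).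
     let n = real j; N' = real N in
     if i = j + 1 then
       n * (\<beta> + n + 1) * (N' - \<beta> - n) / ((N' - \<beta> - 2 * n) * (N' - \<beta> - 2 * n - 1))
     else if j = i + 1 then
       n * (N' - \<beta> - n) * (N' - n + 1) / ((N' - \<beta> - 2 * n) * (N' - \<beta> - 2 * n + 1))
     else if i = j then
       - \<alpha> - n + (\<beta> * n * (n - 1) + n\<^sup>2 * (n - 1)) / (N' - \<beta> - 2 * n + 1)
               - (\<beta> * n * (n + 1) + n * (n + 1)\<^sup>2) / (N' - \<beta> - 2 * n - 1)
     else 0)"

definition Z_mat :: "real \<Rightarrow> nat \<Rightarrow> real mat" where
  "Z_mat \<beta> N = mat (N + 1) (N + 1) (\<lambda>(i, j).
     let n = real j; N' = real N in
     if i = j + 1 then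
       - ((\<beta> + n + 1) * (N' - \<beta> - n) / ((N' - \<beta> - 2 * n) * (N' - \<beta> - 2 * n - 1)))
     else if j = i + 1 then
       - (n * (N' - n + 1) / ((N' - \<beta> - 2 * n) * (N' - \<beta> - 2 * n + 1)))
     else if i = j then
       ((n + 1) * \<beta> + (n + 1)\<^sup>2) / (N' - \<beta> - 2 * n - 1)
         - (\<beta> * n + n\<^sup>2) / (N' - \<beta> - 2 * n + 1)
     else 0)"

(* The family P is indexed by 0..N, and the sum in each recurrence runs down column n of J. *)
definition diagonalized_by ::
    "real mat \<Rightarrow> nat \<Rightarrow> (nat \<Rightarrow> real \<Rightarrow> real) \<Rightarrow> real set \<Rightarrow> bool" where
  "diagonalized_by J N P S \<longleftrightarrow>
     (\<forall>n\<le>N. \<forall>y\<in>S.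
        y * P n y = (if n < N then J $$ (n + 1, n) * P (n + 1) y else 0)
                  + J $$ (n, n) * P n y
                  + (if 0 < n then J $$ (n - 1, n) * P (n - 1) y else 0))"

end

theory Submission
  imports Defs
begin

text \<open>
  In the basis \<open>(-x)\<^sub>k\<close> multiplication by \<open>-x\<close> acts as
  \<open>(-x) (-x)\<^sub>k = (-x)\<^sub>k\<^sub>+\<^sub>1 - k (-x)\<^sub>k\<close>, so the three-term recurrence of the Hahn polynomials becomes,
  coefficient by coefficient, a rational identity in \<open>n\<close> and \<open>k\<close>. At \<open>n = N\<close> the left-over
  term is a multiple of \<open>(-x)\<^sub>N\<^sub>+\<^sub>1\<close>, which vanishes on the grid \<open>x = 0, \<dots>, N\<close>. The entries of
  \<open>X + \<mu> Z\<close> are the coefficients of this recurrence, conjugated by \<open>\<sigma>\<close> and shifted by \<open>-\<alpha> - \<mu>\<close>.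
\<close>

section \<open>Coefficients of the Hahn polynomials and of their recurrence\<close>

text \<open>The coefficient of \<open>pochhammer (- x) k\<close> in the Hahn polynomial of degree
  \<open>r\<close>. The degree is a real number so that one formula also serves the neighbours
  \<open>r + 1\<close> and \<open>r - 1\<close>, including \<open>r - 1 = - 1\<close>.\<close>

definition hahn_coeff :: "real \<Rightarrow> real \<Rightarrow> real \<Rightarrow> real \<Rightarrow> nat \<Rightarrow> real" where
  "hahn_coeff a b M r k =
     pochhammer (- r) k * pochhammer (r + a + b + 1) k /
     (pochhammer (a + 1) k * pochhammer (- M) k * fact k)"

text \<open>With \<open>hahn_down\<close>, these are the classical coefficients A and C of
  \<open>- x Q_n = A Q_(n+1) - (A + C) Q_n + C Q_(n-1)\<close>.\<close>

definition hahn_up :: "real \<Rightarrow> real \<Rightarrow> real \<Rightarrow> real \<Rightarrow> real" where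
  "hahn_up a b M r = (r + a + b + 1) * (r + a + 1) * (M - r) /
     ((2 * r + a + b + 1) * (2 * r + a + b + 2))"

definition hahn_down :: "real \<Rightarrow> real \<Rightarrow> real \<Rightarrow> real \<Rightarrow> real" where
  "hahn_down a b M r = r * (r + a + b + M + 1) * (r + b) /
     ((2 * r + a + b) * (2 * r + a + b + 1))"

text \<open>The factor \<open>pochhammer (- real n) k\<close> vanishes for \<open>k > n\<close>, so
  the cut-off may be any \<open>m\<close> from \<open>n\<close> on. Neighbouring degrees can thus
  share the range \<open>k \<le> N\<close>.\<close>

lemma hahn_eq_sum:
  assumes "n \<le> m"
  shows "hahn n x a b N = (\<Sum>k\<le>m. hahn_coeff a b (real N) (real n) k * pochhammer (- x) k)"
proof -
  have nth: "fps_nth (fps_hypergeo [- real n, real n + a + b + 1, - x] [a + 1, - real N] 1) k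
      = hahn_coeff a b (real N) (real n) k * pochhammer (- x) k" for k
    by (simp add: fps_hypergeo_nth hahn_coeff_def foldl_mult_start)
  have "hahn_coeff a b (real N) (real n) k * pochhammer (- x) k = 0" if "k \<notin> {..m}" for k
    using that assms by (simp add: hahn_coeff_def pochhammer_of_nat_eq_0_lemma)
  then have "(\<Sum>k. hahn_coeff a b (real N) (real n) k * pochhammer (- x) k)
      = (\<Sum>k\<le>m. hahn_coeff a b (real N) (real n) k * pochhammer (- x) k)"
    by (intro suminf_finite) auto
  then show ?thesis
    by (simp only: hahn_def eval_fps_def nth power_one mult_1_right)
qed

lemma hahn_coeff_0 [simp]: "hahn_coeff a b M r 0 = 1"
  by (simp add: hahn_coeff_def)

section \<open>The recurrence, coefficient by coefficient\<close>

text \<open>What remains of the coefficient identity, with \<open>K = k + 1\<close>, once the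
  Pochhammer symbols common to all degrees are cancelled. Both sides are zero at
  \<open>r = 0\<close>, where \<open>2 * r + a + b\<close> may vanish.\<close>

lemma hahn_coeff_recurrence_aux:
  fixes r a b M K :: real
  assumes "2 * r + a + b + 1 \<noteq> 0" "2 * r + a + b + 2 \<noteq> 0" "r = 0 \<or> 2 * r + a + b \<noteq> 0"
  defines "s \<equiv> a + b + 1"
  shows "- r * (r + s) * (a + K) * (K - 1 - M) * K + K * r * (K - 1 - r) * (r + s) * (r + s + K - 1)
    = hahn_up a b M r * ((r + 1) * r * (r + s + K - 1) * (r + s + K)
         + r * (K - 1 - r) * (r + s) * (r + s + K - 1))
    + hahn_down a b M r * ((K - 1 - r) * (K - r) * (r + s - 1) * (r + s)
         + r * (K - 1 - r) * (r + s) * (r + s + K - 1))"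
proof (cases "r = 0")
  case True
  then show ?thesis by (simp add: hahn_down_def)
next
  case False
  \<comment> \<open>Eliminating \<open>b\<close> turns the denominators into \<open>p\<close>,
    \<open>p + 1\<close>, \<open>p + 2\<close>, to which the facts \<open>nz\<close> apply
    literally.\<close>
  define p where "p = 2 * r + a + b"
  have nz: "p \<noteq> 0" "p + 1 \<noteq> 0" "p + 2 \<noteq> 0"
    using assms False by (auto simp: p_def)
  have b: "b = p - 2 * r - a" by (simp add: p_def)
  show ?thesis
    using nz unfolding hahn_up_def hahn_down_def s_def b
    by (simp add: divide_simps) (simp add: algebra_simps)
qed

text \<open>Comparison of the coefficients of \<open>pochhammer (- x) (Suc k)\<close>: on the left,
  multiplication by \<open>- x\<close> raises the index \<open>k\<close> and multiplies the term at
  \<open>Suc k\<close> by \<open>- Suc k\<close>.\<close>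

lemma hahn_coeff_recurrence:
  fixes r a b M :: real
  assumes nz: "2 * r + a + b + 1 \<noteq> 0" "2 * r + a + b + 2 \<noteq> 0" "r = 0 \<or> 2 * r + a + b \<noteq> 0"
    and d: "pochhammer (a + 1) (Suc k) \<noteq> 0" "pochhammer (- M) (Suc k) \<noteq> 0"
  shows "hahn_coeff a b M r k - real (Suc k) * hahn_coeff a b M r (Suc k)
    = hahn_up a b M r * (hahn_coeff a b M (r + 1) (Suc k) - hahn_coeff a b M r (Suc k))
    + hahn_down a b M r * (hahn_coeff a b M (r - 1) (Suc k) - hahn_coeff a b M r (Suc k))"
proof -
  \<comment> \<open>All degrees share the denominator \<open>D\<close>, so only an identity between
    numerators is left.\<close>
  define D where "D = pochhammer (a + 1) (Suc k) * pochhammer (- M) (Suc k) * fact (Suc k)"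
  have D: "D \<noteq> 0" using d by (simp add: D_def)
  have c: "hahn_coeff a b M q (Suc k) = pochhammer (- q) (Suc k) * pochhammer (q + a + b + 1) (Suc k) / D" for q
    by (simp add: hahn_coeff_def D_def)
  have c': "hahn_coeff a b M r k = pochhammer (- r) k * pochhammer (r + a + b + 1) k
       * ((a + 1 + real k) * (- M + real k) * real (Suc k)) / D"
    using d by (simp add: hahn_coeff_def D_def pochhammer_Suc divide_simps)
  have "pochhammer (- r) k * pochhammer (r + a + b + 1) k
       * ((a + 1 + real k) * (- M + real k) * real (Suc k))
     - real (Suc k) * (pochhammer (- r) (Suc k) * pochhammer (r + a + b + 1) (Suc k))
    = hahn_up a b M r * (pochhammer (- (r + 1)) (Suc k) * pochhammer (r + 1 + a + b + 1) (Suc k)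
         - pochhammer (- r) (Suc k) * pochhammer (r + a + b + 1) (Suc k))
    + hahn_down a b M r * (pochhammer (- (r - 1)) (Suc k) * pochhammer (r - 1 + a + b + 1) (Suc k)
         - pochhammer (- r) (Suc k) * pochhammer (r + a + b + 1) (Suc k))"
  proof (cases k)
    \<comment> \<open>Here the symbols have length 1, too short for splitting off two linear factors
      as in the general case.\<close>
    case 0
    define p where "p = 2 * r + a + b"
    have b: "b = p - 2 * r - a" by (simp add: p_def)
    have nz': "p + 1 \<noteq> 0" "p + 2 \<noteq> 0" "r = 0 \<or> p \<noteq> 0" using nz by (auto simp: p_def)
    show ?thesis
    proof (cases "r = 0")
      case True
      then show ?thesis using 0 nz by (simp add: hahn_up_def hahn_down_def divide_simps) (simp add: algebra_simps)
    next
      case False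
      then have "p \<noteq> 0" using nz' by simp
      then show ?thesis using 0 nz' unfolding hahn_up_def hahn_down_def b
        by (simp add: divide_simps) (simp add: algebra_simps)
    qed
  next
    case (Suc j)
    \<comment> \<open>Changing the degree by one only exchanges factors at the ends of the
      Pochhammer symbols; \<open>G\<close> is the part common to the degrees \<open>r - 1\<close>,
      \<open>r\<close>, \<open>r + 1\<close> and to the lower index \<open>k\<close>.\<close>
    define G where "G = pochhammer (1 - r) j * pochhammer (r + a + b + 2) j"
    define K where "K = real k + 1"
    have Kj: "real j = K - 2" using Suc by (simp add: K_def)
    have up: "pochhammer (- (r + 1)) (Suc k) * pochhammer (r + 1 + a + b + 1) (Suc k)
        = G * ((r + 1) * r * (r + a + b + K) * (r + a + b + 1 + K))"
    proof -
      have "pochhammer (- (r + 1)) (Suc k) = (- (r + 1)) * ((- r) * pochhammer (1 - r) j)"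
        unfolding Suc pochhammer_rec[of _ "Suc j"] pochhammer_rec[of _ j] by simp
      moreover have "pochhammer (r + 1 + a + b + 1) (Suc k)
          = pochhammer (r + a + b + 2) j * (r + a + b + K) * (r + a + b + 1 + K)"
        unfolding Suc pochhammer_Suc by (simp add: Kj algebra_simps)
      ultimately show ?thesis by (simp only: G_def) (simp add: algebra_simps)
    qed
    have mid: "pochhammer (- r) (Suc k) * pochhammer (r + a + b + 1) (Suc k)
        = G * (- r * (K - 1 - r) * (r + a + b + 1) * (r + a + b + K))"
    proof -
      have "pochhammer (- r) (Suc k) = (- r) * (pochhammer (1 - r) j * (K - 1 - r))"
        unfolding Suc pochhammer_rec[of _ "Suc j"] pochhammer_Suc[of _ j]
          by (simp add: Kj algebra_simps)
      moreover have "pochhammer (r + a + b + 1) (Suc k)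
          = (r + a + b + 1) * (pochhammer (r + a + b + 2) j * (r + a + b + K))"
        unfolding Suc pochhammer_rec[of _ "Suc j"] pochhammer_Suc[of _ j]
          by (simp add: Kj algebra_simps)
      ultimately show ?thesis by (simp only: G_def) (simp add: algebra_simps)
    qed
    have down: "pochhammer (- (r - 1)) (Suc k) * pochhammer (r - 1 + a + b + 1) (Suc k)
        = G * ((K - 1 - r) * (K - r) * (r + a + b) * (r + a + b + 1))"
    proof -
      have "pochhammer (- (r - 1)) (Suc k) = pochhammer (1 - r) j * (K - 1 - r) * (K - r)"
        unfolding Suc pochhammer_Suc by (simp add: Kj algebra_simps)
      moreover have "pochhammer (r - 1 + a + b + 1) (Suc k)
          = (r + a + b) * ((r + a + b + 1) * pochhammer (r + a + b + 2) j)"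
        unfolding Suc pochhammer_rec[of _ "Suc j"] pochhammer_rec[of _ j] by (simp add: algebra_simps)
      ultimately show ?thesis by (simp only: G_def) (simp add: algebra_simps)
    qed
    have low: "pochhammer (- r) k * pochhammer (r + a + b + 1) k = G * (- r * (r + a + b + 1))"
      unfolding Suc pochhammer_rec[of _ j] by (simp add: G_def algebra_simps)
    note aux = hahn_coeff_recurrence_aux[OF nz, where K = K and M = M]
    show ?thesis
      unfolding up mid down low
      using arg_cong[OF aux, of "\<lambda>t. G * t"] by (simp add: K_def algebra_simps)
  qed
  from arg_cong[OF this, of "\<lambda>t. t / D"] show ?thesis
    unfolding c c'
    by (simp only: times_divide_eq_right flip: diff_divide_distrib add_divide_distrib)
qed

section \<open>The Hahn recurrence on the grid\<close>

lemma hahn_recurrence: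
  fixes a b :: real and n x N :: nat
  assumes n: "n \<le> N" and x: "x \<le> N"
    and nz: "2 * real n + a + b + 1 \<noteq> 0" "2 * real n + a + b + 2 \<noteq> 0"
      "n = 0 \<or> 2 * real n + a + b \<noteq> 0"
    and d: "pochhammer (a + 1) N \<noteq> 0"
  shows "- real x * hahn n (real x) a b N
    = (if n < N then hahn_up a b N n * hahn (n + 1) x a b N else 0)
    - (hahn_up a b N n + hahn_down a b N n) * hahn n x a b N
    + (if 0 < n then hahn_down a b N n * hahn (n - 1) x a b N else 0)"
proof -
  define c where "c = hahn_coeff a b (real N)"
  define P where "P = pochhammer (- real x)"
  define S where "S r = (\<Sum>k\<le>N. c r k * P k)" for r
  define A where "A = hahn_up a b N n"
  define C where "C = hahn_down a b N n"
  have step: "- real x * P k = P (Suc k) - real k * P k" for k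
    by (simp add: P_def pochhammer_Suc algebra_simps)
  \<comment> \<open>The integer \<open>x \<le> N\<close> contributes the factor
    \<open>- x + x = 0\<close>; this removes the top term produced by multiplying by
    \<open>- x\<close>.\<close>
  have P_top: "P (Suc N) = 0"
    using x by (simp add: P_def pochhammer_of_nat_eq_0_lemma)
  have coeff: "c n k - real (Suc k) * c n (Suc k)
      = A * (c (n + 1) (Suc k) - c n (Suc k)) + C * (c (real n - 1) (Suc k) - c n (Suc k))"
    if "k < N" for k
  proof -
    have "pochhammer (a + 1) (Suc k) \<noteq> 0"
      using d that pochhammer_eq_0_mono[of "a + 1" "Suc k" N] by auto
    moreover have "pochhammer (- real N) (Suc k) \<noteq> 0"
      using that by (simp add: pochhammer_of_nat_eq_0_iff)
    ultimately show ?thesis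
      using hahn_coeff_recurrence[of "real n" a b k "real N"] nz
      by (simp add: c_def A_def C_def add.commute)
  qed
  have shift: "(\<Sum>k\<le>N. f k) = f 0 + (\<Sum>k<N. f (Suc k))" for f :: "nat \<Rightarrow> real"
    by (metis lessThan_Suc_atMost sum.lessThan_Suc_shift)
  have "- real x * S n = (\<Sum>k\<le>N. c n k * P (Suc k)) - (\<Sum>k\<le>N. real k * c n k * P k)"
    unfolding S_def sum_distrib_left sum_subtractf[symmetric]
  proof (rule sum.cong)
    fix k
    have "- real x * (c n k * P k) = c n k * (- real x * P k)" by simp
    then show "- real x * (c n k * P k) = c n k * P (Suc k) - real k * c n k * P k"
      unfolding step by (simp add: algebra_simps)
  qed simp
  also have "(\<Sum>k\<le>N. c n k * P (Suc k)) = (\<Sum>k<N. c n k * P (Suc k))"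
    using P_top by (simp flip: lessThan_Suc_atMost)
  also have "(\<Sum>k\<le>N. real k * c n k * P k) = (\<Sum>k<N. real (Suc k) * c n (Suc k) * P (Suc k))"
    by (subst shift) simp
  also have "(\<Sum>k<N. c n k * P (Suc k)) - (\<Sum>k<N. real (Suc k) * c n (Suc k) * P (Suc k))
      = (\<Sum>k<N. (c n k - real (Suc k) * c n (Suc k)) * P (Suc k))"
    by (simp add: sum_subtractf left_diff_distrib)
  also have "\<dots> = (\<Sum>k<N. (A * (c (n + 1) (Suc k) - c n (Suc k))
      + C * (c (real n - 1) (Suc k) - c n (Suc k))) * P (Suc k))"
    using coeff by (intro sum.cong) auto
  \<comment> \<open>The term at index 0 may be added because every constant coefficient is 1, so
    both differences vanish there.\<close>
  also have "\<dots> = (\<Sum>k\<le>N. (A * (c (n + 1) k - c n k) + C * (c (real n - 1) k - c n k)) * P k)"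
    by (subst shift) (simp add: c_def)
  also have "\<dots> = A * S (n + 1) - (A + C) * S n + C * S (real n - 1)"
    unfolding S_def sum_distrib_left sum_subtractf[symmetric] sum.distrib[symmetric]
    by (intro sum.cong) (auto simp: algebra_simps)
  finally have main: "- real x * S n = A * S (n + 1) - (A + C) * S n + C * S (real n - 1)" .
  have S: "hahn m x a b N = S m" if "m \<le> N" for m
    using hahn_eq_sum[OF that] by (simp add: S_def c_def P_def)
  \<comment> \<open>\<open>A\<close> contains the factor \<open>N - n\<close>, so at
    \<open>n = N\<close> the truncated sum \<open>S (N + 1)\<close> drops out; likewise the factor
    \<open>n\<close> of \<open>C\<close> removes \<open>S (- 1)\<close> at
    \<open>n = 0\<close>.\<close>
  have "A = 0" if "\<not> n < N" using that n by (simp add: A_def hahn_up_def)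
  then have 1: "A * S (n + 1) = (if n < N then A * hahn (n + 1) x a b N else 0)"
    using S[of "n + 1"] by auto
  have "C = 0" if "n = 0" using that by (simp add: C_def hahn_down_def)
  then have 2: "C * S (real n - 1) = (if 0 < n then C * hahn (n - 1) x a b N else 0)"
    using S[of "n - 1"] n by (auto simp: of_nat_diff)
  show ?thesis
    using main unfolding 1 2 S[OF n] A_def[symmetric] C_def[symmetric] by simp
qed

section \<open>Matching the recurrence with the entries of \<open>X + \<mu> Z\<close>\<close>

theorem proposition4p8:
  fixes N :: nat and \<alpha> \<beta> \<mu> \<alpha>' \<beta>' :: real
    and \<sigma> :: "nat \<Rightarrow> real" and Q :: "nat \<Rightarrow> real \<Rightarrow> real"
  assumes sub: "\<And>n. n < N \<Longrightarrow>
      (real N - \<beta> - 2 * real n) * (real N - \<beta> - 2 * real n - 1) \<noteq> 0"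
    and super: "\<And>n. 0 < n \<Longrightarrow> n \<le> N \<Longrightarrow>
      (real N - \<beta> - 2 * real n) * (real N - \<beta> - 2 * real n + 1) \<noteq> 0"
    and diag: "\<And>n. n \<le> N \<Longrightarrow> real N - \<beta> - 2 * real n - 1 \<noteq> 0"
    and \<alpha>': "\<alpha>' = - 1 - \<mu>"
    and \<beta>': "\<beta>' = \<beta> + \<mu> - real N"
    and hahn_denom: "\<And>k. k \<le> N \<Longrightarrow> pochhammer (\<alpha>' + 1) k \<noteq> 0"
    and \<sigma>_denom: "\<And>n. n \<le> N \<Longrightarrow> pochhammer (\<alpha>' + \<beta>' + real N + 2) n \<noteq> 0"
    and \<sigma>: "\<And>n. n \<le> N \<Longrightarrow>
      \<sigma> n = (- 1) ^ n * pochhammer (- real N) n / pochhammer (\<alpha>' + \<beta>' + real N + 2) n"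
    and Q: "\<And>n y. n \<le> N \<Longrightarrow> Q n y = \<sigma> n * hahn n (y + \<alpha> + \<mu>) \<alpha>' \<beta>' N"
  shows "diagonalized_by (X_mat \<alpha> \<beta> N + \<mu> \<cdot>\<^sub>m Z_mat \<beta> N) N Q
           {real x - \<alpha> - \<mu> | x. x \<le> N}"
proof -
  define J where "J = X_mat \<alpha> \<beta> N + \<mu> \<cdot>\<^sub>m Z_mat \<beta> N"
  have dims: "dim_row (Z_mat \<beta> N) = N + 1" "dim_col (Z_mat \<beta> N) = N + 1"
    by (simp_all add: Z_mat_def)
  have J: "J $$ (i, j) = X_mat \<alpha> \<beta> N $$ (i, j) + \<mu> * Z_mat \<beta> N $$ (i, j)"
    if "i \<le> N" "j \<le> N" for i j
    using that by (simp add: J_def dims)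
  \<comment> \<open>The ratio of consecutive normalizations, cleared of its denominator. It carries
    the Hahn coefficients over to the off-diagonal entries.\<close>
  have \<sigma>_Suc: "\<sigma> (Suc n) * (\<beta> + real n + 1) = \<sigma> n * (real N - real n)"
    if "n < N" for n
  proof -
    have s: "\<alpha>' + \<beta>' + real N + 2 = \<beta> + 1" by (simp add: \<alpha>' \<beta>')
    define p where "p = pochhammer (\<beta> + 1) n"
    define q where "q = \<beta> + real n + 1"
    have Suc: "pochhammer (\<beta> + 1) (Suc n) = p * q"
      by (simp add: p_def q_def pochhammer_Suc add_ac)
    then have "p \<noteq> 0" "q \<noteq> 0" using \<sigma>_denom[of "Suc n"] that s by auto
    then have "(- 1) ^ Suc n * pochhammer (- real N) (Suc n) / (p * q) * q
        = (- 1) ^ n * pochhammer (- real N) n / p * (real N - real n)"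
      by (simp add: pochhammer_Suc divide_simps) (simp add: algebra_simps)
    then show ?thesis
      using that \<sigma>[of n] \<sigma>[of "Suc n"] unfolding s Suc q_def[symmetric] p_def[symmetric] by simp
  qed
  have "y * Q n y = (if n < N then J $$ (n + 1, n) * Q (n + 1) y else 0)
      + J $$ (n, n) * Q n y + (if 0 < n then J $$ (n - 1, n) * Q (n - 1) y else 0)"
    if n: "n \<le> N" and x: "x \<le> N" and y: "y = real x - \<alpha> - \<mu>" for n x y
  proof (cases "N = 0")
    \<comment> \<open>For \<open>N = 0\<close> the conditions \<open>sub\<close> and
      \<open>super\<close> are vacuous and do not yield \<open>\<beta> \<noteq> 0\<close>, which the
      recurrence would require. The matrix is the scalar \<open>- \<alpha> - \<mu>\<close>, equal to
      the only grid point.\<close>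
    case True
    have "Z_mat \<beta> N $$ (0, 0) = - 1" using True diag[of 0] by (simp add: Z_mat_def field_simps)
    moreover have "X_mat \<alpha> \<beta> N $$ (0, 0) = - \<alpha>" by (simp add: X_mat_def)
    ultimately show ?thesis using True n x y J[of 0 0] by simp
  next
    case False
    define r where "r = real n"
    define M where "M = real N"
    define U where "U = hahn_up \<alpha>' \<beta>' M r"
    define D where "D = hahn_down \<alpha>' \<beta>' M r"
    define h where "h m = hahn m x \<alpha>' \<beta>' N" for m
    \<comment> \<open>Up to sign these are the Hahn denominators
      \<open>2 * r + \<alpha>' + \<beta>' + 1\<close>,
      \<open>2 * r + \<alpha>' + \<beta>' + 2\<close> and
      \<open>2 * r + \<alpha>' + \<beta>'\<close>. The first comes from \<open>sub\<close> at
      \<open>n = 0\<close>, where \<open>N > 0\<close> matters, and is available from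
      \<open>super\<close> for \<open>n > 0\<close>.\<close>
    have nz: "M - \<beta> - 2 * r \<noteq> 0" "M - \<beta> - 2 * r - 1 \<noteq> 0"
      "n = 0 \<or> M - \<beta> - 2 * r + 1 \<noteq> 0"
      using sub[of n] super[of n] diag[of n] n False by (cases "n = 0"; auto simp: r_def M_def)+
    have rec: "- real x * h n = (if n < N then U * h (n + 1) else 0) - (U + D) * h n
        + (if 0 < n then D * h (n - 1) else 0)"
      unfolding h_def U_def D_def r_def M_def
      using nz hahn_denom[of N] by (intro hahn_recurrence n x) (auto simp: \<alpha>' \<beta>' r_def M_def)
    have Qh: "Q m y = \<sigma> m * h m" if "m \<le> N" for m
      using Q[OF that, of y] by (simp add: h_def y)
    have U_eq: "U = (\<beta> + r - M) * (r - \<mu>) * (M - r) / ((M - \<beta> - 2 * r) * (M - \<beta> - 2 * r - 1))"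
      by (simp add: U_def hahn_up_def \<alpha>' \<beta>' M_def algebra_simps)
    have D_eq: "D = r * (r + \<beta>) * (r + \<beta> + \<mu> - M) / ((M - \<beta> - 2 * r) * (M - \<beta> - 2 * r + 1))"
      by (simp add: D_def hahn_down_def \<alpha>' \<beta>' M_def algebra_simps)
    have diag_entry: "J $$ (n, n) = - \<alpha> - \<mu> + U + D"
    proof -
      have "J $$ (n, n) = - \<alpha> - r + (\<beta> * r * (r - 1) + r\<^sup>2 * (r - 1)) / (M - \<beta> - 2 * r + 1)
          - (\<beta> * r * (r + 1) + r * (r + 1)\<^sup>2) / (M - \<beta> - 2 * r - 1)
          + \<mu> * (((r + 1) * \<beta> + (r + 1)\<^sup>2) / (M - \<beta> - 2 * r - 1)
            - (\<beta> * r + r\<^sup>2) / (M - \<beta> - 2 * r + 1))"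
        using n J[of n n] by (simp add: X_mat_def Z_mat_def Let_def r_def M_def)
      also have "\<dots> = - \<alpha> - \<mu> + U + D"
      \<comment> \<open>At \<open>n = 0\<close> the denominator
        \<open>M - \<beta> - 2 * r + 1\<close> may be zero, but it only occurs below numerators with
        the factor \<open>r = 0\<close>.\<close>
      proof (cases "n = 0")
        case True
        then show ?thesis using nz by (simp add: U_eq D_eq r_def divide_simps) (simp add: algebra_simps)
      next
        case False
        define p where "p = M - \<beta> - 2 * r"
        have M: "M = p + \<beta> + 2 * r" by (simp add: p_def)
        have "p \<noteq> 0" "p - 1 \<noteq> 0" "p + 1 \<noteq> 0" using nz False by (auto simp: p_def)
        then show ?thesis unfolding U_eq D_eq p_def[symmetric] unfolding M
          by (simp add: divide_simps) (simp add: algebra_simps power2_eq_square)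
      qed
      finally show ?thesis .
    qed
    \<comment> \<open>\<open>X\<close> and \<open>Z\<close> differ here by the factor
      \<open>- r\<close>, so the sum carries \<open>r - \<mu>\<close>. Its factor
      \<open>\<beta> + r + 1\<close> is traded for \<open>M - r\<close> by
      \<open>\<sigma>_Suc\<close>, which leaves \<open>- U\<close>.\<close>
    have sub_entry: "J $$ (n + 1, n) * \<sigma> (n + 1) = - U * \<sigma> n" if "n < N"
    proof -
      define p where "p = (M - \<beta> - 2 * r) * (M - \<beta> - 2 * r - 1)"
      have "J $$ (n + 1, n) = r * (\<beta> + r + 1) * (M - \<beta> - r) / p
          + \<mu> * (- ((\<beta> + r + 1) * (M - \<beta> - r) / p))"
        using that J[of "n + 1" n] by (simp add: X_mat_def Z_mat_def Let_def r_def M_def p_def)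
      also have "\<dots> = (r - \<mu>) * (M - \<beta> - r) / p * (\<beta> + r + 1)"
        by (simp add: diff_divide_distrib[symmetric] algebra_simps)
      finally have "J $$ (n + 1, n) * \<sigma> (n + 1)
          = (r - \<mu>) * (M - \<beta> - r) / p * (\<sigma> (Suc n) * (\<beta> + r + 1))" by simp
      also have "\<sigma> (Suc n) * (\<beta> + r + 1) = \<sigma> n * (M - r)"
        using \<sigma>_Suc[OF that] by (simp add: r_def M_def)
      also have "(r - \<mu>) * (M - \<beta> - r) / p * (\<sigma> n * (M - r)) = - U * \<sigma> n"
        unfolding U_eq p_def[symmetric]
        by (simp add: minus_divide_left algebra_simps flip: add_divide_distrib diff_divide_distrib)
      finally show ?thesis .
    qed
    \<comment> \<open>The same exchange one index lower: \<open>M - r + 1\<close> at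
      \<open>n - 1\<close> becomes \<open>\<beta> + r\<close> at \<open>n\<close>.\<close>
    have super_entry: "J $$ (n - 1, n) * \<sigma> (n - 1) = - D * \<sigma> n" if "0 < n"
    proof -
      define p where "p = (M - \<beta> - 2 * r) * (M - \<beta> - 2 * r + 1)"
      have "J $$ (n - 1, n) = r * (M - \<beta> - r) * (M - r + 1) / p + \<mu> * (- (r * (M - r + 1) / p))"
        using that n J[of "n - 1" n] by (auto simp: X_mat_def Z_mat_def Let_def r_def M_def p_def)
      also have "\<dots> = r * (M - \<beta> - r - \<mu>) / p * (M - r + 1)"
        by (simp add: diff_divide_distrib[symmetric] algebra_simps)
      finally have "J $$ (n - 1, n) * \<sigma> (n - 1)
          = r * (M - \<beta> - r - \<mu>) / p * (\<sigma> (n - 1) * (M - r + 1))" by simp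
      also have "\<sigma> (n - 1) * (M - r + 1) = \<sigma> n * (\<beta> + r)"
        using \<sigma>_Suc[of "n - 1"] that n by (simp add: r_def M_def of_nat_diff algebra_simps)
      also have "r * (M - \<beta> - r - \<mu>) / p * (\<sigma> n * (\<beta> + r)) = - D * \<sigma> n"
        unfolding D_eq p_def[symmetric]
        by (simp add: minus_divide_left algebra_simps flip: add_divide_distrib diff_divide_distrib)
      finally show ?thesis .
    qed
    have 1: "(if n < N then J $$ (n + 1, n) * Q (n + 1) y else 0)
        = - \<sigma> n * (if n < N then U * h (n + 1) else 0)"
      using sub_entry Qh[of "n + 1"] by (simp flip: mult.assoc)
    have 2: "(if 0 < n then J $$ (n - 1, n) * Q (n - 1) y else 0)
        = - \<sigma> n * (if 0 < n then D * h (n - 1) else 0)"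
      using super_entry Qh[of "n - 1"] n by (simp flip: mult.assoc)
    \<comment> \<open>Since \<open>y = x - \<alpha> - \<mu>\<close>, the recurrence is used with
      reversed sign; this accounts for the minus signs in the off-diagonal identities and for
      \<open>U + D\<close> on the diagonal.\<close>
    have "y * Q n y = - \<sigma> n * (- real x * h n) - (\<alpha> + \<mu>) * (\<sigma> n * h n)"
      unfolding Qh[OF n] unfolding y by (simp add: algebra_simps)
    then show ?thesis
      unfolding rec 1 2 diag_entry Qh[OF n] by (simp add: algebra_simps split del: if_split)
  qed
  then show ?thesis
    unfolding diagonalized_by_def J_def[symmetric] by blast
qed

end
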